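(* Let $T$ be the weighted graph with multiplicities $\{\ell_{nk}\}$, $\{r_{nk}\}$ described in the context. The function $V\mapsto \ell_{00}V_{10}$ is an ordered homeomorphism of the sequential boundary $\partial_\uparrow\mathcal V$ with order $\lhd$ into $[0,1]$ with order $>$; that is, it maps $\partial_\uparrow\mathcal V$ homeomorphically onto its image in $[0,1]$, and for all $V,V'\in\partial_\uparrow\mathcal V$ one has $V\lhd V'$ if and only if $\ell_{00}V_{10}>\ell_{00}V'_{10}$.
   Context: Let $T_n=\{(n,0),(n,1),\ldots,(n,n)\}$ and $T=\bigcup_{n\ge 0}T_n$. $T$ is a directed graph in which every node $(n,k)$ has two outgoing edges, $(n,k)\to(n+1,k)$ with multiplicity $\ell_{nk}$ and $(n,k)\to(n+1,k+1)$ with multiplicity $r_{nk}$, where $\{\ell_{nk};(n,k)\in T\}$ and $\{r_{nk};(n,k)\in T\}$ are given triangular arrays of strictly positive real numbers. $\mathcal V$ is the set of nonnegative functions $V=\{V_{nk};(n,k)\in T\}$ satisfying $V_{nk}=\ell_{nk}V_{n+1,k}+r_{nk}V_{n+1,k+1}$ for all $(n,k)\in T$ and $V_{00}=1$, endowed with the product topology of functions on $T$ (pointwise convergence). The weight of a directed path in $T$ is the product of the multiplicities of its edges. The dimension $D_{nk}$ is the sum of the weights of all paths from $(0,0)$ to $(n,k)$ (with $D_{00}=1$). For $V\in\mathcal V$, $\mathbb P_V$ denotes the law of the inhomogeneous Markov chain $K_\bullet=(K_0,K_1,\ldots)$, with $K_n\in\{0,\ldots,n\}$, having marginal distributions $\mathbb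 P_V(K_n=k)=D_{nk}V_{nk}$ and backward transition probabilities, for $0\le k\le n$, $n>0$, $$\mathbb P_V(K_{n-1}=j\mid K_n=k)=\frac{D_{n-1,j}}{D_{nk}}\bigl(\ell_{n-1,j}\delta_{jk}+r_{n-1,j}\delta_{j,k-1}\bigr).$$ For integers $0\le\varkappa\le\nu$, $V^{\nu\varkappa}$ is the function on $T$ that satisfies $V^{\nu\varkappa}_{nk}=\ell_{nk}V^{\nu\varkappa}_{n+1,k}+r_{nk}V^{\nu\varkappa}_{n+1,k+1}$ for $n<\nu$, satisfies $V^{\nu\varkappa}_{\nu k}=\delta_{k\varkappa}/D_{\nu\varkappa}$ for $0\le k\le\nu$, and equals $0$ on $\bigcup_{n>\nu}T_n$. Equivalently, for $n\le\nu$, $V^{\nu\varkappa}_{nk}=D^{\nu\varkappa}_{nk}/D_{\nu\varkappa}$, where $D^{\nu\varkappa}_{nk}$ is the sum of the weights of all paths from $(n,k)$ to $(\nu,\varkappa)$. An infinite path in $T$ is a sequence $\{\varkappa(\nu);\nu=0,1,\ldots\}$ with $\varkappa(0)=0$ and $\varkappa(\nu+1)-\varkappa(\nu)\in\{0,1\}$ for all $\nu$. The sequential boundary $\partial_\uparrow\mathcal V$ is the set of elements $V\in\mathcal V$ representable as limits $V=\lim_{\nu\to\infty}V^{\nu,\varkappa(\nu)}$ taken along infinite paths $\{\varkappa(\nu)\}$ in $T$. The relation $\lhd$ on $\partial_\uparrow\mathcal V$: $V\lhd V'$ means that for every $n>0$ the variable $K_n$ under $\mathbb P_V$ is strictly stochastically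 smaller than $K_n$ under $\mathbb P_{V'}$, i.e. $\mathbb P_V(K_n\le k)\ge\mathbb P_{V'}(K_n\le k)$ for all $k$, with strict inequality for at least one $k$. *)

theory Defs
  imports "HOL-Probability.Probability"
begin

definition tri :: "(nat \<times> nat) set" where
  "tri = {(n, k). k \<le> n}"

text \<open>
  Throughout, \<open>l (n, k)\<close> and \<open>r (n, k)\<close> are the multiplicities of the edges
  \<open>(n, k) \<rightarrow> (n + 1, k)\<close> and \<open>(n, k) \<rightarrow> (n + 1, k + 1)\<close>. A function on the graph is an
  element of \<open>extensional tri\<close>, so that the product topology over the index set \<open>tri\<close> is
  the topology of pointwise convergence on the nodes.
\<close>

abbreviation fun_topology :: "(nat \<times> nat \<Rightarrow> real) topology" where
  "fun_topology \<equiv> product_topology (\<lambda>_. euclideanreal) tri"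

definition harmonic_funs ::
    "(nat \<times> nat \<Rightarrow> real) \<Rightarrow> (nat \<times> nat \<Rightarrow> real) \<Rightarrow> (nat \<times> nat \<Rightarrow> real) set" where
  "harmonic_funs l r = {V \<in> extensional tri.
     (\<forall>(n, k)\<in>tri. V (n, k) \<ge> 0) \<and>
     (\<forall>(n, k)\<in>tri. V (n, k) = l (n, k) * V (Suc n, k) + r (n, k) * V (Suc n, Suc k)) \<and>
     V (0, 0) = 1}"

text \<open>
  A path from \<open>(n, k)\<close> to \<open>(m, j)\<close> visits \<open>(i, p i)\<close> for \<open>n \<le> i \<le> m\<close>.
\<close>

definition paths :: "nat \<times> nat \<Rightarrow> nat \<times> nat \<Rightarrow> (nat \<Rightarrow> nat) set" where
  "paths = (\<lambda>(n, k) (m, j). {p \<in> extensional {n..m}. p n = k \<and> p m = j \<and>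
     (\<forall>i\<in>{n..<m}. p (Suc i) = p i \<or> p (Suc i) = Suc (p i))})"

definition path_weight ::
    "(nat \<times> nat \<Rightarrow> real) \<Rightarrow> (nat \<times> nat \<Rightarrow> real) \<Rightarrow> nat \<Rightarrow> nat \<Rightarrow> (nat \<Rightarrow> nat) \<Rightarrow> real" where
  "path_weight l r n m p =
     (\<Prod>i\<in>{n..<m}. if p (Suc i) = p i then l (i, p i) else r (i, p i))"

definition dimension ::
    "(nat \<times> nat \<Rightarrow> real) \<Rightarrow> (nat \<times> nat \<Rightarrow> real) \<Rightarrow> nat \<Rightarrow> nat \<Rightarrow> real" where
  "dimension l r n k = (\<Sum>p\<in>paths (0, 0) (n, k). path_weight l r 0 n p)"

text \<open>
  The process is realised canonically: \<open>K\<^sub>n\<close> is the coordinate map \<open>\<omega> \<mapsto> \<omega> n\<close> on the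
  product of the sets \<open>{0..n}\<close>. The Markov property in reversed time is the statement that
  the conditional law of \<open>K\<^sub>n\<close> given \<open>K\<close> at times \<open>n + 1, \<dots>, m\<close> is the backward
  transition probability from the state at time \<open>n + 1\<close>.
\<close>

definition backward_prob ::
    "(nat \<times> nat \<Rightarrow> real) \<Rightarrow> (nat \<times> nat \<Rightarrow> real) \<Rightarrow> nat \<Rightarrow> nat \<Rightarrow> nat \<Rightarrow> real" where
  "backward_prob l r n k j = dimension l r n j / dimension l r (Suc n) k *
     (l (n, j) * of_bool (j = k) + r (n, j) * of_bool (Suc j = k))"

definition is_chain_law ::
    "(nat \<times> nat \<Rightarrow> real) \<Rightarrow> (nat \<times> nat \<Rightarrow> real) \<Rightarrow> (nat \<times> nat \<Rightarrow> real) \<Rightarrow>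
     (nat \<Rightarrow> nat) measure \<Rightarrow> bool" where
  "is_chain_law l r V M \<longleftrightarrow>
     prob_space M \<and> sets M = sets (Pi\<^sub>M UNIV (\<lambda>n. count_space {0..n})) \<and>
     (\<forall>(n, k)\<in>tri. \<P>(\<omega> in M. \<omega> n = k) = dimension l r n k * V (n, k)) \<and>
     (\<forall>n m x j. n < m \<longrightarrow> j \<le> n \<longrightarrow> \<P>(\<omega> in M. \<forall>i\<in>{Suc n..m}. \<omega> i = x i) > 0 \<longrightarrow>
        \<P>(\<omega> in M. \<omega> n = j \<bar> \<forall>i\<in>{Suc n..m}. \<omega> i = x i) = backward_prob l r n (x (Suc n)) j)"

definition chain_law ::
    "(nat \<times> nat \<Rightarrow> real) \<Rightarrow> (nat \<times> nat \<Rightarrow> real) \<Rightarrow> (nat \<times> nat \<Rightarrow> real) \<Rightarrow>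
     (nat \<Rightarrow> nat) measure" where
  "chain_law l r V = (THE M. is_chain_law l r V M)"

function V_rec ::
    "(nat \<times> nat \<Rightarrow> real) \<Rightarrow> (nat \<times> nat \<Rightarrow> real) \<Rightarrow> nat \<Rightarrow> nat \<Rightarrow> nat \<Rightarrow> nat \<Rightarrow> real" where
  "V_rec l r \<nu> \<kappa> n k =
     (if n < \<nu> then l (n, k) * V_rec l r \<nu> \<kappa> (Suc n) k + r (n, k) * V_rec l r \<nu> \<kappa> (Suc n) (Suc k)
      else if n = \<nu> then of_bool (k = \<kappa>) / dimension l r \<nu> \<kappa>
      else 0)"
  by pat_completeness auto
termination by (relation "Wellfounded.measure (\<lambda>(l, r, \<nu>, \<kappa>, n, k). \<nu> - n)") auto

declare V_rec.simps [simp del]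

definition V_fin ::
    "(nat \<times> nat \<Rightarrow> real) \<Rightarrow> (nat \<times> nat \<Rightarrow> real) \<Rightarrow> nat \<Rightarrow> nat \<Rightarrow> nat \<times> nat \<Rightarrow> real" where
  "V_fin l r \<nu> \<kappa> = (\<lambda>(n, k)\<in>tri. V_rec l r \<nu> \<kappa> n k)"

definition infinite_path :: "(nat \<Rightarrow> nat) \<Rightarrow> bool" where
  "infinite_path \<kappa> \<longleftrightarrow> \<kappa> 0 = 0 \<and> (\<forall>\<nu>. \<kappa> (Suc \<nu>) = \<kappa> \<nu> \<or> \<kappa> (Suc \<nu>) = Suc (\<kappa> \<nu>))"

definition sequential_boundary ::
    "(nat \<times> nat \<Rightarrow> real) \<Rightarrow> (nat \<times> nat \<Rightarrow> real) \<Rightarrow> (nat \<times> nat \<Rightarrow> real) set" where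
  "sequential_boundary l r = {V \<in> harmonic_funs l r.
     \<exists>\<kappa>. infinite_path \<kappa> \<and> limitin fun_topology (\<lambda>\<nu>. V_fin l r \<nu> (\<kappa> \<nu>)) V sequentially}"

definition stoch_less ::
    "(nat \<times> nat \<Rightarrow> real) \<Rightarrow> (nat \<times> nat \<Rightarrow> real) \<Rightarrow>
     (nat \<times> nat \<Rightarrow> real) \<Rightarrow> (nat \<times> nat \<Rightarrow> real) \<Rightarrow> bool" where
  "stoch_less l r V V' \<longleftrightarrow> (\<forall>n>0.
     (\<forall>k. \<P>(\<omega> in chain_law l r V. \<omega> n \<le> k) \<ge> \<P>(\<omega> in chain_law l r V'. \<omega> n \<le> k)) \<and>
     (\<exists>k. \<P>(\<omega> in chain_law l r V. \<omega> n \<le> k) > \<P>(\<omega> in chain_law l r V'. \<omega> n \<le> k)))"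

end

theory Submission imports Defs begin

text \<open>
  Every harmonic function \<open>V\<close> yields a Markov chain with the same backward transition probabilities,
  so a conditional probability \<open>P (K\<^sub>n \<le> k | K\<^sub>\<nu> = \<kappa>)\<close> does not depend on \<open>V\<close>; it is the value
  belonging to \<open>V\<^sup>\<nu>\<^sup>\<kappa>\<close>. As a function of \<open>(\<nu>, \<kappa>)\<close> it is a martingale in reversed time, and since the
  backward chain moves by 0 or -1, consecutive rows interlace
  (\<open>reverse_martingale_interlace\<close>). Interlacing has two consequences.

  Weak monotonicity: \<open>P (K\<^sub>n \<le> k | K\<^sub>\<nu> = \<kappa>)\<close> decreases in \<open>\<kappa>\<close>. Two infinite paths always satisfy
  \<open>\<kappa> \<nu> \<le> \<kappa>' \<nu>\<close> infinitely often, or the opposite inequality, so any two elements of the sequential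
  boundary are stochastically comparable at all times simultaneously, always in the same direction
  (\<open>boundary_total_order\<close>).

  Strict monotonicity: \<open>h\<^sub>n k = P (K\<^sub>1 = 0 | K\<^sub>n = k)\<close> decreases strictly in \<open>k\<close>. The number
  \<open>l (0, 0) * V (1, 0) = P (K\<^sub>1 = 0)\<close> is the mean of \<open>h\<^sub>n\<close> under the law of \<open>K\<^sub>n\<close>, so for two elements
  with distribution functions \<open>F\<^sub>n\<close> and \<open>F'\<^sub>n\<close>, summation by parts (\<open>cum_diff_expand\<close>) gives
  \<open>P (K\<^sub>1 = 0) - P' (K\<^sub>1 = 0) = \<Sum>k<n. (F\<^sub>n k - F'\<^sub>n k) * (h\<^sub>n k - h\<^sub>n (k + 1))\<close>.

  On the boundary all terms of this sum have one sign. Hence \<open>F\<^sub>n k\<close>, and with it every coordinate of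
  \<open>V\<close>, is a Lipschitz function of \<open>P (K\<^sub>1 = 0)\<close>, which proves the embedding; and a strict
  inequality between the values of \<open>P (K\<^sub>1 = 0)\<close> forces the laws of \<open>K\<^sub>n\<close> to differ for every
  \<open>n > 0\<close>, which proves the statement about the order.

  The order refers to the law of the chain, whose definition as the unique measure with given
  properties carries information only after existence and uniqueness are known. Uniqueness holds because the
  conditions determine the probabilities of all cylinders; existence follows from the theorem of
  Ionescu Tulcea, applied to the forward transition probabilities of the chain.
\<close>

lemma sum_by_parts:
  fixes p h :: "nat \<Rightarrow> 'a::comm_ring_1"
  shows "(\<Sum>k\<le>n. p k * h k) = (\<Sum>k\<le>n. p k) * h n + (\<Sum>k<n. (\<Sum>j\<le>k. p j) * (h k - h (Suc k)))"
  by (induction n) (auto simp: algebra_simps)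

section \<open>Weighted triangles and the dimensions of their nodes\<close>

locale weighted_triangle =
  fixes l r :: "nat \<times> nat \<Rightarrow> real"
  assumes l_pos: "k \<le> n \<Longrightarrow> 0 < l (n, k)"
    and r_pos: "k \<le> n \<Longrightarrow> 0 < r (n, k)"
begin

abbreviation D :: "nat \<Rightarrow> nat \<Rightarrow> real" where
  "D \<equiv> dimension l r"

text \<open>
  Extended by zero to all pairs of nodes on adjacent levels, the multiplicities form one matrix for
  each level, and the recursions for dimensions, harmonic functions and cylinder probabilities
  become matrix products.
\<close>

definition edge :: "nat \<Rightarrow> nat \<Rightarrow> nat \<Rightarrow> real" where
  "edge n j k = l (n, j) * of_bool (j = k) + r (n, j) * of_bool (Suc j = k)"

lemma edge_nonneg: "j \<le> n \<Longrightarrow> 0 \<le> edge n j k"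
  using l_pos[of j n] r_pos[of j n] by (simp add: edge_def)

lemma edge_eq_0: "k \<noteq> j \<Longrightarrow> k \<noteq> Suc j \<Longrightarrow> edge n j k = 0"
  by (simp add: edge_def)

lemma sum_edge_source:
  assumes "k \<le> Suc n"
  shows "(\<Sum>j\<le>n. f j * edge n j k) =
    (if k \<le> n then l (n, k) * f k else 0) + (if k = 0 then 0 else r (n, k - 1) * f (k - 1))"
proof -
  have "(\<Sum>j\<le>n. f j * edge n j k) =
      (\<Sum>j\<le>n. if j = k then l (n, k) * f k else 0) +
      (\<Sum>j\<le>n. if j = k - 1 then (if k = 0 then 0 else r (n, k - 1) * f (k - 1)) else 0)"
    unfolding sum.distrib[symmetric] by (rule sum.cong) (auto simp: edge_def)
  then show ?thesis
    using assms by auto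
qed

lemma sum_edge_target:
  assumes "j \<le> n"
  shows "(\<Sum>k\<le>Suc n. edge n j k * f k) = l (n, j) * f j + r (n, j) * f (Suc j)"
proof -
  have "(\<Sum>k\<le>Suc n. edge n j k * f k) =
      (\<Sum>k\<le>Suc n. if k = j then l (n, j) * f j else 0) +
      (\<Sum>k\<le>Suc n. if k = Suc j then r (n, j) * f (Suc j) else 0)"
    unfolding sum.distrib[symmetric] by (rule sum.cong) (auto simp: edge_def)
  then show ?thesis
    using assms by auto
qed

lemma path_le_time:
  assumes "p \<in> paths (0, 0) (n, k)" "i \<le> n"
  shows "p i \<le> i"
  using assms(2)
proof (induction i)
  case 0
  then show ?case using assms(1) by (simp add: paths_def)
next
  case (Suc i)
  then have "p (Suc i) = p i \<or> p (Suc i) = Suc (p i)"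
    using assms(1) by (simp add: paths_def)
  with Suc show ?case by auto
qed

lemma finite_paths_root: "finite (paths (0, 0) (n, k))"
proof (rule finite_subset)
  show "paths (0, 0) (n, k) \<subseteq> (\<Pi>\<^sub>E i\<in>{0..n}. {..n})"
  proof
    fix p assume p: "p \<in> paths (0, 0) (n, k)"
    have "p i \<in> {..n}" if "i \<in> {0..n}" for i
      using path_le_time[OF p, of i] that by simp
    then show "p \<in> (\<Pi>\<^sub>E i\<in>{0..n}. {..n})"
      using p by (simp add: paths_def PiE_iff)
  qed
qed (simp add: finite_PiE)

lemma D_eq_0: "n < k \<Longrightarrow> D n k = 0"
proof -
  assume "n < k"
  moreover have "p n = k" if "p \<in> paths (0, 0) (n, k)" for p
    using that by (simp add: paths_def)
  ultimately have "paths (0, 0) (n, k) = {}"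
    using path_le_time[of _ n k n] by fastforce
  then show ?thesis by (simp add: dimension_def)
qed

lemma D_0: "D 0 k = of_bool (k = 0)"
proof (cases "k = 0")
  case True
  have "paths (0, 0) (0, 0) = {\<lambda>i\<in>{0}. 0}"
    by (auto simp: paths_def fun_eq_iff extensional_def restrict_def)
  then show ?thesis using True by (simp add: dimension_def path_weight_def)
qed (simp add: D_eq_0)

text \<open>
  Cutting off the last edge is a bijection from the paths to \<open>(n + 1, k)\<close> onto the pairs of
  a parent of that node and a path to the parent.
\<close>

lemma D_Suc:
  assumes "k \<le> Suc n"
  shows "D (Suc n) k = (\<Sum>j\<le>n. D n j * edge n j k)"
proof -
  let ?J = "{j. j \<le> n \<and> (j = k \<or> Suc j = k)}"
  have "D (Suc n) k = (\<Sum>(j, p)\<in>Sigma ?J (\<lambda>j. paths (0, 0) (n, j)).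
      path_weight l r 0 n p * edge n j k)"
    unfolding dimension_def
  proof (rule sum.reindex_bij_witness[of _ "\<lambda>(j, p). p(Suc n := k)"
        "\<lambda>q. (q n, restrict q {0..n})"], goal_cases)
    case (1 q)
    then show ?case
      by (auto simp: paths_def fun_eq_iff extensional_def restrict_def not_le)
  next
    case (2 q)
    moreover have "q n \<le> n"
      using path_le_time[OF 2, of n] by simp
    ultimately show ?case
      by (force simp: paths_def)
  next
    case (3 b)
    then show ?case
      by (auto simp: paths_def fun_eq_iff extensional_def restrict_def)
  next
    case (4 b)
    obtain j p where b: "b = (j, p)" and j: "j = k \<or> Suc j = k" "j \<le> n"
      and p: "p \<in> paths (0, 0) (n, j)"
      using 4 by auto
    have "(p(Suc n := k)) (Suc i) = (p(Suc n := k)) i \<or>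
        (p(Suc n := k)) (Suc i) = Suc ((p(Suc n := k)) i)" if "i \<le> n" for i
      using p j that by (cases "i = n") (auto simp: paths_def)
    then show ?case
      using p b by (simp add: paths_def extensional_def)
  next
    case (5 q)
    have "path_weight l r 0 n (restrict q {0..n}) = path_weight l r 0 n q"
      unfolding path_weight_def by (intro prod.cong) auto
    with 5 show ?case
      by (auto simp: path_weight_def edge_def paths_def)
  qed
  also have "\<dots> = (\<Sum>j\<in>?J. D n j * edge n j k)"
    by (subst sum.Sigma[symmetric])
       (auto simp: finite_paths_root dimension_def sum_distrib_right)
  also have "\<dots> = (\<Sum>j\<le>n. D n j * edge n j k)"
    by (rule sum.mono_neutral_left) (auto simp: edge_def)
  finally show ?thesis .
qed

lemma D_pos: "k \<le> n \<Longrightarrow> 0 < D n k"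
proof (induction n arbitrary: k)
  case (Suc n)
  have "D (Suc n) k =
      (if k \<le> n then l (n, k) * D n k else 0) + (if k = 0 then 0 else r (n, k - 1) * D n (k - 1))"
    using Suc.prems by (simp add: D_Suc sum_edge_source)
  moreover have "k \<le> n \<Longrightarrow> 0 < l (n, k) * D n k"
    using Suc.IH l_pos by simp
  moreover have "k \<noteq> 0 \<Longrightarrow> 0 < r (n, k - 1) * D n (k - 1)"
    using Suc.IH[of "k - 1"] r_pos[of "k - 1" n] Suc.prems by simp
  ultimately show ?case
    using Suc.prems by (cases "k = 0"; cases "k \<le> n") auto
qed (simp add: D_0)

lemma D_nonneg: "0 \<le> D n k"
  using D_pos[of k n] D_eq_0[of n k] by (cases "k \<le> n") auto

section \<open>Reverse martingales and interlacing\<close>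

text \<open>
  Dividing by \<open>D (Suc n) k\<close> shows the condition to be
  \<open>g (n + 1) k = E (g n K\<^sub>n | K\<^sub>n\<^sub>+\<^sub>1 = k)\<close>: from time \<open>m\<close> on, \<open>g n K\<^sub>n\<close> is a martingale in
  reversed time for the backward transition probabilities. These are the same for every
  harmonic function. The product form keeps the condition linear and free of division.
\<close>

definition reverse_martingale :: "nat \<Rightarrow> (nat \<Rightarrow> nat \<Rightarrow> real) \<Rightarrow> bool" where
  "reverse_martingale m g \<longleftrightarrow> (\<forall>n\<ge>m. \<forall>k\<le>Suc n.
     D (Suc n) k * g (Suc n) k = (\<Sum>j\<le>n. D n j * g n j * edge n j k))"

lemma reverse_martingale_const: "reverse_martingale m (\<lambda>_ _. c)"
  unfolding reverse_martingale_def by (simp add: D_Suc sum_distrib_right) (simp add: mult_ac)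

text \<open>
  The backward chain moves from \<open>k + 1\<close> either to \<open>k + 1\<close> or to \<open>k\<close>, so each interior value of
  row \<open>n + 1\<close> is a proper convex combination of two neighbours in row \<open>n\<close>; at the two ends of a
  row the move is forced.
\<close>

lemma reverse_martingale_interlace:
  assumes g: "reverse_martingale m g" and n: "m \<le> n"
  shows reverse_martingale_left: "g (Suc n) 0 = g n 0"
    and reverse_martingale_right: "g (Suc n) (Suc n) = g n n"
    and reverse_martingale_between: "k < n \<Longrightarrow> g n (Suc k) \<le> g n k \<Longrightarrow>
      g (Suc n) (Suc k) \<in> {g n (Suc k)..g n k}"
    and reverse_martingale_strictly_between: "k < n \<Longrightarrow> g n (Suc k) < g n k \<Longrightarrow>
      g (Suc n) (Suc k) \<in> {g n (Suc k)<..<g n k}"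
proof -
  have gn: "D (Suc n) k * g (Suc n) k =
      (if k \<le> n then l (n, k) * (D n k * g n k) else 0) +
      (if k = 0 then 0 else r (n, k - 1) * (D n (k - 1) * g n (k - 1)))" if "k \<le> Suc n" for k
    using g n that
    by (simp only: reverse_martingale_def sum_edge_source[where f = "\<lambda>j. D n j * g n j"])
  have Dn: "D (Suc n) k =
      (if k \<le> n then l (n, k) * D n k else 0) + (if k = 0 then 0 else r (n, k - 1) * D n (k - 1))"
    if "k \<le> Suc n" for k
    using that by (simp only: D_Suc sum_edge_source)
  show "g (Suc n) 0 = g n 0"
    using gn[of 0] Dn[of 0] D_pos[of 0 n] l_pos[of 0 n] by simp
  show "g (Suc n) (Suc n) = g n n"
    using gn[of "Suc n"] Dn[of "Suc n"] D_pos[of n n] r_pos[of n n] by simp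
  define a b where "a = l (n, Suc k) * D n (Suc k)" and "b = r (n, k) * D n k"
  have ab: "0 < a" "0 < b" and avg: "(a + b) * g (Suc n) (Suc k) = a * g n (Suc k) + b * g n k"
    if k: "k < n"
    using k D_pos l_pos r_pos gn[of "Suc k"] Dn[of "Suc k"] by (simp_all add: a_def b_def)
  show "g (Suc n) (Suc k) \<in> {g n (Suc k)..g n k}" if k: "k < n" and le: "g n (Suc k) \<le> g n k"
  proof -
    have "(a + b) * g n (Suc k) \<le> (a + b) * g (Suc n) (Suc k)"
      "(a + b) * g (Suc n) (Suc k) \<le> (a + b) * g n k"
      using mult_left_mono[OF le, of a] mult_left_mono[OF le, of b] ab[OF k]
      unfolding avg[OF k] by (simp_all add: distrib_right)
    then show ?thesis using ab[OF k] by simp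
  qed
  show "g (Suc n) (Suc k) \<in> {g n (Suc k)<..<g n k}" if k: "k < n" and less: "g n (Suc k) < g n k"
  proof -
    have "(a + b) * g n (Suc k) < (a + b) * g (Suc n) (Suc k)"
      "(a + b) * g (Suc n) (Suc k) < (a + b) * g n k"
      using mult_strict_left_mono[OF less ab(1)[OF k]] mult_strict_left_mono[OF less ab(2)[OF k]]
      unfolding avg[OF k] by (simp_all add: distrib_right)
    then show ?thesis using ab[OF k] by simp
  qed
qed

text \<open>
  Interlacing gives \<open>g (n + 1) (k + 1) \<le> g n k \<le> g (n + 1) k\<close>, so monotonicity of one row
  passes to the next.
\<close>

lemma reverse_martingale_antimono:
  assumes g: "reverse_martingale m g" and init: "\<And>k. k < m \<Longrightarrow> g m (Suc k) \<le> g m k"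
    and "m \<le> n" "i \<le> j" "j \<le> n"
  shows "g n j \<le> g n i"
proof -
  have adj: "k < n \<Longrightarrow> g n (Suc k) \<le> g n k" for k
    using \<open>m \<le> n\<close>
  proof (induction n arbitrary: k rule: dec_induct)
    case base
    then show ?case by (rule init)
  next
    case (step n)
    have "g (Suc n) (Suc k) \<le> g n k"
      using reverse_martingale_between[OF g step.hyps(1), of k] step.IH[of k] step.prems
        reverse_martingale_right[OF g step.hyps(1)]
      by (cases "k = n") auto
    also have "g n k \<le> g (Suc n) k"
      using reverse_martingale_between[OF g step.hyps(1), of "k - 1"] step.IH[of "k - 1"] step.prems
        reverse_martingale_left[OF g step.hyps(1)]
      by (cases k) auto
    finally show ?case .
  qed
  show ?thesis
    using assms(4,5)
  proof (induction j rule: dec_induct)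
    case (step j)
    then show ?case using adj[of j] by simp
  qed simp
qed

text \<open>
  At least one of the two inequalities around \<open>g n k\<close> is strict: both are equalities only when
  the move is forced both from \<open>k\<close> and from \<open>k + 1\<close>, that is, when \<open>n = 0\<close>.
  Hence the positivity of the initial time.
\<close>

lemma reverse_martingale_strict:
  assumes g: "reverse_martingale m g" and "0 < m" and init: "\<And>k. k < m \<Longrightarrow> g m (Suc k) < g m k"
    and "m \<le> n" "k < n"
  shows "g n (Suc k) < g n k"
  using assms(4,5)
proof (induction n arbitrary: k rule: dec_induct)
  case base
  then show ?case by (rule init)
next
  case (step n)
  have right: "g (Suc n) (Suc k) < g n k" if "k < n" for k
    using reverse_martingale_strictly_between[OF g step.hyps(1) that step.IH[OF that]] by simp
  have left: "g n (Suc k) < g (Suc n) (Suc k)" if "k < n" for k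
    using reverse_martingale_strictly_between[OF g step.hyps(1) that step.IH[OF that]] by simp
  show ?case
  proof (cases k)
    case 0
    then show ?thesis
      using right[of 0] reverse_martingale_left[OF g step.hyps(1)] step.hyps(1) \<open>0 < m\<close> by simp
  next
    case (Suc k')
    then have "g n k < g (Suc n) k"
      using left[of k'] step.prems by simp
    moreover have "g (Suc n) (Suc k) \<le> g n k"
      using right[of k] reverse_martingale_right[OF g step.hyps(1)] step.prems
      by (cases "k = n") auto
    ultimately show ?thesis by simp
  qed
qed

section \<open>Distribution functions of the chain\<close>

text \<open>
  Paths to \<open>(\<nu> + 1, \<kappa>)\<close> pass through one of the parents of that node. Multiplying by the
  dimension removes the normalization of \<open>V\<^sup>\<nu>\<^sup>\<kappa>\<close> and leaves a recursion in the target.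
\<close>

lemma V_rec_reverse:
  assumes "n \<le> \<nu>" "k \<le> n" "\<kappa> \<le> Suc \<nu>"
  shows "D (Suc \<nu>) \<kappa> * V_rec l r (Suc \<nu>) \<kappa> n k =
    (\<Sum>j\<le>\<nu>. D \<nu> j * V_rec l r \<nu> j n k * edge \<nu> j \<kappa>)"
  using assms(1,2)
proof (induction n arbitrary: k rule: inc_induct)
  case base
  have top: "V_rec l r N c N i = of_bool (i = c) / D N c" for N c i
    by (simp add: V_rec.simps)
  have "D (Suc \<nu>) \<kappa> * V_rec l r (Suc \<nu>) \<kappa> \<nu> k = edge \<nu> k \<kappa>"
    using D_pos[OF assms(3)]
    by (subst V_rec.simps) (auto simp: top edge_def)
  moreover have "(\<Sum>j\<le>\<nu>. D \<nu> j * V_rec l r \<nu> j \<nu> k * edge \<nu> j \<kappa>) =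
      (\<Sum>j\<le>\<nu>. if j = k then edge \<nu> k \<kappa> else 0)"
  proof (rule sum.cong)
    fix j assume "j \<in> {..\<nu>}"
    then show "D \<nu> j * V_rec l r \<nu> j \<nu> k * edge \<nu> j \<kappa> = (if j = k then edge \<nu> k \<kappa> else 0)"
      using D_pos[of j \<nu>] by (auto simp: top)
  qed simp
  ultimately show ?case using base by simp
next
  case (step n)
  have "D (Suc \<nu>) \<kappa> * V_rec l r (Suc \<nu>) \<kappa> n k =
      l (n, k) * (D (Suc \<nu>) \<kappa> * V_rec l r (Suc \<nu>) \<kappa> (Suc n) k) +
      r (n, k) * (D (Suc \<nu>) \<kappa> * V_rec l r (Suc \<nu>) \<kappa> (Suc n) (Suc k))"
    using step.hyps by (subst V_rec.simps) (simp add: algebra_simps)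
  also have "\<dots> = (\<Sum>j\<le>\<nu>. D \<nu> j * V_rec l r \<nu> j n k * edge \<nu> j \<kappa>)"
    using step.prems step.hyps
    by (simp add: step.IH V_rec.simps[of l r \<nu> _ n k] sum_distrib_left sum.distrib[symmetric]
        algebra_simps)
  finally show ?case .
qed

text \<open>
  For harmonic \<open>V\<close> this is the distribution function of \<open>K\<^sub>n\<close>. The sum stops at \<open>n\<close>, because
  outside the triangle \<open>V\<close> is undefined.
\<close>

definition cum :: "(nat \<times> nat \<Rightarrow> real) \<Rightarrow> nat \<Rightarrow> nat \<Rightarrow> real" where
  "cum V n k = (\<Sum>j\<le>min k n. D n j * V (n, j))"

text \<open>
  For \<open>V\<^sup>\<nu>\<^sup>\<kappa>\<close> the distribution function at \<open>k\<close> is the conditional probability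
  \<open>P (K\<^sub>n \<le> k | K\<^sub>\<nu> = \<kappa>)\<close>, a reverse martingale in \<open>(\<nu>, \<kappa>)\<close>.
\<close>

lemma reverse_martingale_cum:
  "reverse_martingale n (\<lambda>\<nu> \<kappa>. cum (V_fin l r \<nu> \<kappa>) n k)"
  unfolding reverse_martingale_def
proof (intro allI impI)
  fix \<nu> \<kappa> assume *: "n \<le> \<nu>" "\<kappa> \<le> Suc \<nu>"
  have cum_V: "cum (V_fin l r N c) n k = (\<Sum>i\<le>min k n. D n i * V_rec l r N c n i)" for N c
    by (auto simp: cum_def V_fin_def tri_def intro!: sum.cong)
  have "D (Suc \<nu>) \<kappa> * cum (V_fin l r (Suc \<nu>) \<kappa>) n k =
      (\<Sum>i\<le>min k n. D n i * (D (Suc \<nu>) \<kappa> * V_rec l r (Suc \<nu>) \<kappa> n i))"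
    by (simp add: cum_V sum_distrib_left mult_ac)
  also have "\<dots> = (\<Sum>i\<le>min k n. \<Sum>j\<le>\<nu>. D n i * (D \<nu> j * V_rec l r \<nu> j n i * edge \<nu> j \<kappa>))"
    using * by (intro sum.cong) (auto simp: V_rec_reverse sum_distrib_left)
  also have "\<dots> = (\<Sum>j\<le>\<nu>. D \<nu> j * cum (V_fin l r \<nu> j) n k * edge \<nu> j \<kappa>)"
    by (subst sum.swap) (simp add: cum_V sum_distrib_left sum_distrib_right mult_ac)
  finally show "D (Suc \<nu>) \<kappa> * cum (V_fin l r (Suc \<nu>) \<kappa>) n k =
      (\<Sum>j\<le>\<nu>. D \<nu> j * cum (V_fin l r \<nu> j) n k * edge \<nu> j \<kappa>)" .
qed

lemma cum_V_fin_diag: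
  assumes "\<kappa> \<le> n"
  shows "cum (V_fin l r n \<kappa>) n k = of_bool (\<kappa> \<le> k)"
proof -
  have "cum (V_fin l r n \<kappa>) n k = (\<Sum>j\<le>min k n. if j = \<kappa> then 1 else 0)"
    unfolding cum_def using D_pos[OF assms]
    by (intro sum.cong) (auto simp: V_fin_def tri_def V_rec.simps)
  then show ?thesis using assms by auto
qed

text \<open>
  Backward chains started further to the right stay stochastically to the right. This comes
  from interlacing, since at time \<open>n\<close> the conditional probability is the indicator of
  \<open>\<kappa> \<le> k\<close>.
\<close>

lemma cum_V_fin_antimono:
  assumes "n \<le> \<nu>" "\<kappa> \<le> \<kappa>'" "\<kappa>' \<le> \<nu>"
  shows "cum (V_fin l r \<nu> \<kappa>') n k \<le> cum (V_fin l r \<nu> \<kappa>) n k"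
  using reverse_martingale_antimono[where g = "\<lambda>\<nu> \<kappa>. cum (V_fin l r \<nu> \<kappa>) n k",
      OF reverse_martingale_cum _ assms]
  by (simp add: cum_V_fin_diag)

lemma harmonic_rec:
  assumes "V \<in> harmonic_funs l r" "k \<le> n"
  shows "V (n, k) = l (n, k) * V (Suc n, k) + r (n, k) * V (Suc n, Suc k)"
proof -
  have "\<forall>(n, k)\<in>tri. V (n, k) = l (n, k) * V (Suc n, k) + r (n, k) * V (Suc n, Suc k)"
    using assms(1) unfolding harmonic_funs_def by blast
  then show ?thesis
    using assms(2) unfolding tri_def by blast
qed

lemma harmonic_nonneg: "V \<in> harmonic_funs l r \<Longrightarrow> k \<le> n \<Longrightarrow> 0 \<le> V (n, k)"
  unfolding harmonic_funs_def tri_def by blast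

lemma harmonic_root: "V \<in> harmonic_funs l r \<Longrightarrow> V (0, 0) = 1"
  unfolding harmonic_funs_def by blast

lemma harmonic_extensional: "V \<in> harmonic_funs l r \<Longrightarrow> V \<in> extensional tri"
  unfolding harmonic_funs_def by blast

lemma sum_edge_harmonic:
  assumes "V \<in> harmonic_funs l r" "j \<le> n"
  shows "(\<Sum>k\<le>Suc n. edge n j k * V (Suc n, k)) = V (n, j)"
  unfolding sum_edge_target[OF assms(2)] by (rule harmonic_rec[OF assms, symmetric])

text \<open>
  A martingale has constant expectation; here the marginal law of \<open>K\<^sub>n\<close> is \<open>D n k * V (n, k)\<close>.
\<close>

lemma reverse_martingale_pairing:
  assumes V: "V \<in> harmonic_funs l r" and g: "reverse_martingale m g" and "m \<le> n"
  shows "(\<Sum>k\<le>n. D n k * V (n, k) * g n k) = (\<Sum>k\<le>m. D m k * V (m, k) * g m k)"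
  using \<open>m \<le> n\<close>
proof (induction n rule: dec_induct)
  case (step n)
  have "(\<Sum>k\<le>Suc n. D (Suc n) k * V (Suc n, k) * g (Suc n) k) =
      (\<Sum>k\<le>Suc n. (\<Sum>j\<le>n. D n j * g n j * edge n j k) * V (Suc n, k))"
    using g step.hyps by (intro sum.cong) (auto simp: reverse_martingale_def mult_ac)
  also have "\<dots> = (\<Sum>j\<le>n. D n j * g n j * (\<Sum>k\<le>Suc n. edge n j k * V (Suc n, k)))"
    unfolding sum_distrib_right sum_distrib_left
    by (subst sum.swap) (simp add: mult_ac del: sum.atMost_Suc)
  also have "\<dots> = (\<Sum>j\<le>n. D n j * V (n, j) * g n j)"
    by (intro sum.cong refl) (simp only: atMost_iff sum_edge_harmonic[OF V], simp add: mult_ac)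
  finally show ?case using step.IH by simp
qed simp

lemma cum_top:
  assumes "V \<in> harmonic_funs l r" "n \<le> k"
  shows "cum V n k = 1"
  using reverse_martingale_pairing[OF assms(1) reverse_martingale_const[of 0 1], of n]
    harmonic_root[OF assms(1)] assms(2)
  by (simp add: cum_def min_absorb2 D_0)

lemma cum_1_0: "cum V 1 0 = l (0, 0) * V (1, 0)"
  using D_Suc[of 0 0] by (simp add: cum_def D_0 edge_def)

lemma cum_diff:
  assumes "k \<le> n"
  shows "D n k * V (n, k) = cum V n k - (if k = 0 then 0 else cum V n (k - 1))"
  using assms by (cases k) (auto simp: cum_def min_absorb1)

text \<open>
  The drop of \<open>P (K\<^sub>1 = 0 | K\<^sub>n = k)\<close> from \<open>k\<close> to \<open>k + 1\<close>.
\<close>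

definition slope :: "nat \<Rightarrow> nat \<Rightarrow> real" where
  "slope n k = cum (V_fin l r n k) 1 0 - cum (V_fin l r n (Suc k)) 1 0"

text \<open>
  Row 1 of this reverse martingale is \<open>1, 0\<close>, so strictness starts there.
\<close>

lemma slope_pos: "0 < n \<Longrightarrow> k < n \<Longrightarrow> 0 < slope n k"
  unfolding slope_def
  using reverse_martingale_strict[where g = "\<lambda>\<nu> \<kappa>. cum (V_fin l r \<nu> \<kappa>) 1 0",
      OF reverse_martingale_cum, of n k]
  by (simp add: cum_V_fin_diag)

text \<open>
  \<open>P (K\<^sub>1 = 0)\<close> is the mean of the strictly decreasing function \<open>k \<mapsto> P (K\<^sub>1 = 0 | K\<^sub>n = k)\<close>
  under the law of \<open>K\<^sub>n\<close>. Summation by parts writes the difference of two such means in terms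
  of the difference of the distribution functions at time \<open>n\<close>. For stochastically ordered laws all
  terms have the same sign, so the single number \<open>P (K\<^sub>1 = 0)\<close> controls everything.
\<close>

lemma cum_diff_expand:
  assumes V: "V \<in> harmonic_funs l r" and V': "V' \<in> harmonic_funs l r" and n: "0 < n"
  shows "cum V 1 0 - cum V' 1 0 = (\<Sum>k<n. (cum V n k - cum V' n k) * slope n k)"
proof -
  have *: "cum U 1 0 = cum (V_fin l r n n) 1 0 + (\<Sum>k<n. cum U n k * slope n k)"
    if U: "U \<in> harmonic_funs l r" for U
  proof -
    have "cum U 1 0 = (\<Sum>k\<le>n. D n k * U (n, k) * cum (V_fin l r n k) 1 0)"
      using reverse_martingale_pairing[where g = "\<lambda>\<nu> \<kappa>. cum (V_fin l r \<nu> \<kappa>) 1 0",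
          OF U reverse_martingale_cum, of n] n
      by (simp add: cum_V_fin_diag) (simp add: cum_def)
    also have "\<dots> = cum U n n * cum (V_fin l r n n) 1 0 + (\<Sum>k<n. cum U n k * slope n k)"
      unfolding sum_by_parts[of "\<lambda>k. D n k * U (n, k)"]
      by (simp add: cum_def slope_def min_absorb1)
    finally show ?thesis using cum_top[OF U] by simp
  qed
  show ?thesis
    unfolding *[OF V] *[OF V'] by (simp add: left_diff_distrib sum_subtractf)
qed

section \<open>The order and the topology of the sequential boundary\<close>

lemma boundary_harmonic: "V \<in> sequential_boundary l r \<Longrightarrow> V \<in> harmonic_funs l r"
  by (simp add: sequential_boundary_def)

lemma infinite_path_le: "infinite_path \<kappa> \<Longrightarrow> \<kappa> \<nu> \<le> \<nu>"
  by (induction \<nu>) (auto simp: infinite_path_def le_Suc_eq, metis le_Suc_eq not_less_eq_eq)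

lemma boundary_cum_limit:
  assumes "V \<in> sequential_boundary l r"
  obtains \<kappa> where "\<And>\<nu>. \<kappa> \<nu> \<le> \<nu>"
    "\<And>n k. (\<lambda>\<nu>. cum (V_fin l r \<nu> (\<kappa> \<nu>)) n k) \<longlonglongrightarrow> cum V n k"
proof -
  obtain \<kappa> where path: "infinite_path \<kappa>"
    and lim: "limitin fun_topology (\<lambda>\<nu>. V_fin l r \<nu> (\<kappa> \<nu>)) V sequentially"
    using assms by (auto simp: sequential_boundary_def)
  have "(\<lambda>\<nu>. V_fin l r \<nu> (\<kappa> \<nu>) x) \<longlonglongrightarrow> V x" if "x \<in> tri" for x
    using lim that by (simp add: limitin_componentwise)
  then have "(\<lambda>\<nu>. cum (V_fin l r \<nu> (\<kappa> \<nu>)) n k) \<longlonglongrightarrow> cum V n k" for n k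
    unfolding cum_def by (intro tendsto_sum tendsto_mult tendsto_const) (auto simp: tri_def)
  with infinite_path_le[OF path] that show ?thesis by blast
qed

text \<open>
  Of two infinite paths, one is weakly to the left of the other at infinitely many times. At those
  times the approximating laws are stochastically ordered, and the order survives in the limit.
\<close>

lemma boundary_total_order:
  assumes V: "V \<in> sequential_boundary l r" and V': "V' \<in> sequential_boundary l r"
  shows "(\<forall>n k. cum V' n k \<le> cum V n k) \<or> (\<forall>n k. cum V n k \<le> cum V' n k)"
proof -
  obtain \<kappa> where \<kappa>: "\<And>\<nu>. \<kappa> \<nu> \<le> \<nu>"
    "\<And>n k. (\<lambda>\<nu>. cum (V_fin l r \<nu> (\<kappa> \<nu>)) n k) \<longlonglongrightarrow> cum V n k"
    using boundary_cum_limit[OF V] by blast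
  obtain \<kappa>' where \<kappa>': "\<And>\<nu>. \<kappa>' \<nu> \<le> \<nu>"
    "\<And>n k. (\<lambda>\<nu>. cum (V_fin l r \<nu> (\<kappa>' \<nu>)) n k) \<longlonglongrightarrow> cum V' n k"
    using boundary_cum_limit[OF V'] by blast
  \<comment> \<open>Stated for arbitrary limits, because either of the two paths can be the left one.\<close>
  have frequent: "cum W' n k \<le> cum W n k"
    if freq: "\<exists>\<^sub>F \<nu> in sequentially. c \<nu> \<le> c' \<nu>" and c': "\<And>\<nu>. c' \<nu> \<le> \<nu>"
      and lim: "(\<lambda>\<nu>. cum (V_fin l r \<nu> (c \<nu>)) n k) \<longlonglongrightarrow> cum W n k"
      and lim': "(\<lambda>\<nu>. cum (V_fin l r \<nu> (c' \<nu>)) n k) \<longlonglongrightarrow> cum W' n k"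
    for c c' W W' n k
  proof (rule ccontr)
    assume "\<not> ?thesis"
    then have neg: "cum W n k - cum W' n k < 0" by simp
    have "\<forall>\<^sub>F \<nu> in sequentially. cum (V_fin l r \<nu> (c \<nu>)) n k - cum (V_fin l r \<nu> (c' \<nu>)) n k < 0"
      by (rule order_tendstoD(2)[OF tendsto_diff[OF lim lim'] neg])
    with eventually_ge_at_top[of n] have "\<forall>\<^sub>F \<nu> in sequentially. \<not> c \<nu> \<le> c' \<nu>"
    proof eventually_elim
      case (elim \<nu>)
      then show ?case using cum_V_fin_antimono[of n \<nu> "c \<nu>" "c' \<nu>" k] c' by fastforce
    qed
    with freq show False by (simp add: frequently_def)
  qed
  show ?thesis
  proof (cases "\<exists>\<^sub>F \<nu> in sequentially. \<kappa> \<nu> \<le> \<kappa>' \<nu>")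
    case True
    then show ?thesis using frequent[OF True] \<kappa> \<kappa>' by blast
  next
    case False
    then have "\<forall>\<^sub>F \<nu> in sequentially. \<kappa>' \<nu> \<le> \<kappa> \<nu>"
      by (simp add: not_frequently not_le eventually_mono less_imp_le)
    then have "\<exists>\<^sub>F \<nu> in sequentially. \<kappa>' \<nu> \<le> \<kappa> \<nu>"
      by (simp add: eventually_frequently)
    then show ?thesis using frequent[of \<kappa>' \<kappa>] \<kappa> \<kappa>' by blast
  qed
qed

text \<open>
  The sum for \<open>P (K\<^sub>1 = 0)\<close> has nonnegative terms, so it bounds each of them.
\<close>

lemma cum_lipschitz_ordered:
  assumes V: "V \<in> harmonic_funs l r" and V': "V' \<in> harmonic_funs l r"
    and le: "\<And>n k. cum V' n k \<le> cum V n k" and k: "k < n"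
  shows "cum V n k - cum V' n k \<le> (cum V 1 0 - cum V' 1 0) / slope n k"
proof -
  have "(cum V n k - cum V' n k) * slope n k \<le> (\<Sum>k<n. (cum V n k - cum V' n k) * slope n k)"
    using k le slope_pos[of n]
    by (intro member_le_sum) (auto intro!: mult_nonneg_nonneg intro: less_imp_le)
  also have "\<dots> = cum V 1 0 - cum V' 1 0"
    using cum_diff_expand[OF V V', of n] k by simp
  finally show ?thesis
    using slope_pos[of n k] k by (simp add: pos_le_divide_eq)
qed

lemma cum_lipschitz:
  obtains C where "\<And>V V'. V \<in> sequential_boundary l r \<Longrightarrow> V' \<in> sequential_boundary l r \<Longrightarrow>
    \<bar>cum V n k - cum V' n k\<bar> \<le> C * \<bar>cum V 1 0 - cum V' 1 0\<bar>"
proof (cases "k < n")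
  case True
  have "\<bar>cum V n k - cum V' n k\<bar> \<le> 1 / slope n k * \<bar>cum V 1 0 - cum V' 1 0\<bar>"
    if "V \<in> sequential_boundary l r" "V' \<in> sequential_boundary l r" for V V'
    using boundary_total_order[OF that] cum_lipschitz_ordered[of V V' k n]
      cum_lipschitz_ordered[of V' V k n] that[THEN boundary_harmonic] True
    by (auto simp: abs_if) (smt (verit))+
  then show ?thesis using that by blast
next
  case False
  then have "\<bar>cum V n k - cum V' n k\<bar> \<le> 0 * \<bar>cum V 1 0 - cum V' 1 0\<bar>"
    if "V \<in> sequential_boundary l r" "V' \<in> sequential_boundary l r" for V V'
    using that[THEN boundary_harmonic] cum_top by simp
  then show ?thesis using that by blast
qed

text \<open>
  The values of \<open>V\<close> are differences of distribution functions divided by dimensions. The Lipschitz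
  bound yields both injectivity of \<open>V \<mapsto> P (K\<^sub>1 = 0)\<close> and continuity of its inverse.
\<close>

lemma coordinate_lipschitz:
  assumes "k \<le> n"
  obtains C where "\<And>V V'. V \<in> sequential_boundary l r \<Longrightarrow> V' \<in> sequential_boundary l r \<Longrightarrow>
    \<bar>V (n, k) - V' (n, k)\<bar> \<le> C * \<bar>cum V 1 0 - cum V' 1 0\<bar>"
proof -
  obtain C where C: "\<And>V V'. V \<in> sequential_boundary l r \<Longrightarrow> V' \<in> sequential_boundary l r \<Longrightarrow>
    \<bar>cum V n k - cum V' n k\<bar> \<le> C * \<bar>cum V 1 0 - cum V' 1 0\<bar>"
    using cum_lipschitz by blast
  obtain C' where C': "\<And>V V'. V \<in> sequential_boundary l r \<Longrightarrow> V' \<in> sequential_boundary l r \<Longrightarrow>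
    \<bar>cum V n (k - 1) - cum V' n (k - 1)\<bar> \<le> C' * \<bar>cum V 1 0 - cum V' 1 0\<bar>"
    using cum_lipschitz by blast
  have D: "0 < D n k" using assms by (rule D_pos)
  have "\<bar>V (n, k) - V' (n, k)\<bar> \<le> (C + max C' 0) / D n k * \<bar>cum V 1 0 - cum V' 1 0\<bar>"
    if "V \<in> sequential_boundary l r" "V' \<in> sequential_boundary l r" for V V'
  proof -
    let ?t = "\<bar>cum V 1 0 - cum V' 1 0\<bar>"
    have "D n k * \<bar>V (n, k) - V' (n, k)\<bar> = \<bar>D n k * V (n, k) - D n k * V' (n, k)\<bar>"
      using D by (simp add: abs_mult flip: right_diff_distrib)
    also have "\<dots> \<le> \<bar>cum V n k - cum V' n k\<bar> +
        (if k = 0 then 0 else \<bar>cum V n (k - 1) - cum V' n (k - 1)\<bar>)"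
      unfolding cum_diff[OF assms] by (cases "k = 0") auto
    also have "\<dots> \<le> C * ?t + max C' 0 * ?t"
      using C[OF that] C'[OF that] mult_right_mono[of C' "max C' 0" ?t]
      by (intro add_mono) auto
    finally show ?thesis using D by (simp add: field_simps)
  qed
  then show ?thesis using that by blast
qed

lemma boundary_embedding:
  "embedding_map (subtopology fun_topology (sequential_boundary l r)) (top_of_set {0..1})
     (\<lambda>V. l (0, 0) * V (1, 0))"
proof -
  let ?S = "sequential_boundary l r" and ?f = "\<lambda>V. l (0, 0) * V (1, 0)"
  let ?X = "subtopology fun_topology ?S"
  have f_cum: "?f V = cum V 1 0" for V
    by (simp only: cum_1_0)
  have ext: "V \<in> extensional tri" if "V \<in> ?S" for V
    using boundary_harmonic[OF that] by (rule harmonic_extensional)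
  have X: "topspace ?X = ?S"
    using ext by (simp add: PiE_def) blast
  have range: "?f ` ?S \<subseteq> {0..1}"
  proof
    fix t assume "t \<in> ?f ` ?S"
    then obtain V where V: "V \<in> ?S" and t: "t = ?f V" by auto
    note h = boundary_harmonic[OF V]
    show "t \<in> {0..1}"
      using harmonic_rec[OF h, of 0 0] harmonic_root[OF h] t
        mult_nonneg_nonneg[OF less_imp_le[OF l_pos[of 0 0]] harmonic_nonneg[OF h, of 0 1]]
        mult_nonneg_nonneg[OF less_imp_le[OF r_pos[of 0 0]] harmonic_nonneg[OF h, of 1 1]]
      by simp
  qed
  have inj: "inj_on ?f ?S"
  proof (rule inj_onI)
    fix V V' assume VV': "V \<in> ?S" "V' \<in> ?S" and eq: "?f V = ?f V'"
    show "V = V'"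
    proof (rule extensionalityI[OF ext ext])
      fix x assume "x \<in> tri"
      then obtain n k where x: "x = (n, k)" "k \<le> n" by (auto simp: tri_def)
      obtain C where "\<bar>V (n, k) - V' (n, k)\<bar> \<le> C * \<bar>cum V 1 0 - cum V' 1 0\<bar>"
        using coordinate_lipschitz[OF x(2)] VV' by metis
      with eq x show "V x = V' x" by (simp only: f_cum) simp
    qed (use VV' in auto)
  qed
  define g where "g = inv_into ?S ?f"
  have g_S: "g t \<in> ?S" and fg: "?f (g t) = t" if "t \<in> ?f ` ?S" for t
    using inv_into_into[OF that] f_inv_into_f[OF that] by (simp_all add: g_def)
  have gf: "g (?f V) = V" if "V \<in> ?S" for V
    unfolding g_def by (rule inv_into_f_f[OF inj that])
  have cont_g: "continuous_on (?f ` ?S) (\<lambda>t. g t x)" if "x \<in> tri" for x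
  proof -
    obtain n k where x: "x = (n, k)" "k \<le> n" using \<open>x \<in> tri\<close> by (auto simp: tri_def)
    obtain C where C: "\<And>V V'. V \<in> ?S \<Longrightarrow> V' \<in> ?S \<Longrightarrow>
        \<bar>V (n, k) - V' (n, k)\<bar> \<le> C * \<bar>cum V 1 0 - cum V' 1 0\<bar>"
      using coordinate_lipschitz[OF x(2)] by blast
    have "\<bar>g s x - g t x\<bar> \<le> max C 0 * \<bar>s - t\<bar>" if "s \<in> ?f ` ?S" "t \<in> ?f ` ?S" for s t
    proof -
      have "\<bar>g s x - g t x\<bar> \<le> C * \<bar>s - t\<bar>"
        using C[OF g_S[OF that(1)] g_S[OF that(2)]] fg[OF that(1)] fg[OF that(2)]
        by (simp only: x(1) f_cum)
      also have "\<dots> \<le> max C 0 * \<bar>s - t\<bar>"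
        by (intro mult_right_mono) auto
      finally show ?thesis .
    qed
    then have "(max C 0)-lipschitz_on (?f ` ?S) (\<lambda>t. g t x)"
      by (intro lipschitz_onI) (auto simp: dist_real_def)
    then show ?thesis by (rule lipschitz_on_continuous_on)
  qed
  have "homeomorphic_maps ?X (top_of_set (?f ` ?S)) ?f g"
    unfolding homeomorphic_maps_def
  proof (intro conjI ballI)
    have "continuous_map ?X euclideanreal ?f"
      by (intro continuous_map_from_subtopology continuous_map_real_mult_left
          continuous_map_product_projection) (simp add: tri_def)
    then show "continuous_map ?X (top_of_set (?f ` ?S)) ?f"
      using X by (auto simp: continuous_map_in_subtopology)
    have "continuous_map (top_of_set (?f ` ?S)) fun_topology g"
      using g_S ext cont_g
      by (auto simp: continuous_map_componentwise)
    then show "continuous_map (top_of_set (?f ` ?S)) ?X g"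
      using g_S by (auto simp: continuous_map_in_subtopology)
  qed (use X gf fg in auto)
  then have "homeomorphic_map ?X (subtopology (top_of_set {0..1}) (?f ` topspace ?X)) ?f"
    using range X by (auto simp: homeomorphic_map_maps subtopology_subtopology Int_absorb1)
  then show ?thesis by (simp add: embedding_map_def)
qed

lemma cum_strict_somewhere:
  assumes "V \<in> harmonic_funs l r" "V' \<in> harmonic_funs l r" "0 < n"
    "cum V' 1 0 < cum V 1 0" "\<And>k. cum V' n k \<le> cum V n k"
  shows "\<exists>k. cum V' n k < cum V n k"
proof (rule ccontr)
  assume "\<not> ?thesis"
  then have "cum V' n k = cum V n k" for k
    using assms(5)[of k] by (auto simp: not_less intro: antisym)
  then show False
    using cum_diff_expand[OF assms(1-3)] assms(4) by simp
qed

text \<open>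
  If \<open>P (K\<^sub>1 = 0)\<close> differs, totality of the weak order leaves only one direction, and equality
  of the laws at a later time would force equality at time 1. Conversely, at time 1 the value at 0 is
  the only one at which the two distribution functions can differ.
\<close>

lemma boundary_order:
  assumes V: "V \<in> sequential_boundary l r" and V': "V' \<in> sequential_boundary l r"
  shows "(\<forall>n>0. (\<forall>k. cum V' n k \<le> cum V n k) \<and> (\<exists>k. cum V' n k < cum V n k)) \<longleftrightarrow>
    cum V' 1 0 < cum V 1 0" (is "?L \<longleftrightarrow> ?R")
proof
  assume ?L
  then obtain k where k: "cum V' 1 k < cum V 1 k" by auto
  then have "k = 0"
    using cum_top[of _ 1 k] V V' boundary_harmonic by (cases "k = 0") auto
  with k show ?R by simp
next
  assume R: ?R
  then have "cum V' n k \<le> cum V n k" for n k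
    using boundary_total_order[OF V V'] by (metis not_less)
  then show ?L
    using cum_strict_somewhere[OF V[THEN boundary_harmonic] V'[THEN boundary_harmonic]] R by blast
qed


section \<open>The law of the chain is unique\<close>

abbreviation chain_space :: "(nat \<Rightarrow> nat) measure" where
  "chain_space \<equiv> Pi\<^sub>M UNIV (\<lambda>n. count_space {0..n})"

text \<open>
  For harmonic \<open>V\<close>, the probability that the chain follows \<open>x\<close> during \<open>{n..m}\<close> is this number
  times \<open>V (m, x m)\<close>; it is zero if \<open>x\<close> does not follow edges of the triangle there.
\<close>

definition path_mass :: "nat \<Rightarrow> nat \<Rightarrow> (nat \<Rightarrow> nat) \<Rightarrow> real" where
  "path_mass n m x = D n (x n) * (\<Prod>i\<in>{n..<m}. edge i (x i) (x (Suc i)))"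

lemma chain_space_le: "\<omega> \<in> space chain_space \<Longrightarrow> \<omega> i \<le> i"
  by (auto simp: space_PiM PiE_iff)

lemma chain_event:
  assumes M: "sets M = sets chain_space" and "finite I"
  shows "{\<omega>\<in>space M. \<forall>i\<in>I. Q i (\<omega> i)} \<in> sets M"
proof -
  have "{\<omega>\<in>space M. Q i (\<omega> i)} \<in> sets M" for i
  proof -
    have "(\<lambda>\<omega>. \<omega> i) \<in> measurable M (count_space {0..i})"
      using measurable_component_singleton[of i UNIV "\<lambda>n. count_space {0..n}"]
      by (simp add: measurable_cong_sets[OF M refl])
    moreover have "{j\<in>{0..i}. Q i j} \<in> sets (count_space {0..i})" by auto
    ultimately
    have "(\<lambda>\<omega>. \<omega> i) -` {j\<in>{0..i}. Q i j} \<inter> space M \<in> sets M"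
      by (rule measurable_sets)
    also have "(\<lambda>\<omega>. \<omega> i) -` {j\<in>{0..i}. Q i j} \<inter> space M = {\<omega>\<in>space M. Q i (\<omega> i)}"
      using chain_space_le by (auto simp: sets_eq_imp_space_eq[OF M])
    finally show ?thesis .
  qed
  then show ?thesis
    using \<open>finite I\<close> by (intro sets.sets_Collect_finite_All)
qed

lemma D_edge_eq_0:
  assumes "Suc n < k"
  shows "D n j * edge n j k = 0"
proof (cases "j \<le> n")
  case True
  with assms show ?thesis by (simp add: edge_eq_0)
qed (simp add: D_eq_0)

lemma path_mass_Suc_left:
  "n < m \<Longrightarrow> D (Suc n) (x (Suc n)) * path_mass n m x =
    D n (x n) * edge n (x n) (x (Suc n)) * path_mass (Suc n) m x"
  by (simp add: path_mass_def prod.atLeast_Suc_lessThan)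

lemma path_mass_eq_0:
  assumes "path_mass 0 m x \<noteq> 0" "i \<le> m"
  shows "x i \<le> i"
  using assms(2)
proof (induction i)
  case 0
  then show ?case using assms(1) by (auto simp: path_mass_def D_0)
next
  case (Suc i)
  then have "edge i (x i) (x (Suc i)) \<noteq> 0"
    using assms(1) by (simp add: path_mass_def)
  with Suc show ?case using edge_eq_0[of "x (Suc i)" "x i" i] by fastforce
qed

lemma sum_path_mass:
  assumes "n < m"
  shows "(\<Sum>j\<le>n. path_mass n m (x(n := j))) = path_mass (Suc n) m x"
proof -
  have "path_mass n m (x(n := j)) =
      D n j * edge n j (x (Suc n)) * (\<Prod>i\<in>{Suc n..<m}. edge i (x i) (x (Suc i)))" for j
    using assms by (simp add: path_mass_def prod.atLeast_Suc_lessThan)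
  then have "(\<Sum>j\<le>n. path_mass n m (x(n := j))) =
      (\<Sum>j\<le>n. D n j * edge n j (x (Suc n))) * (\<Prod>i\<in>{Suc n..<m}. edge i (x i) (x (Suc i)))"
    by (simp add: sum_distrib_right)
  also have "(\<Sum>j\<le>n. D n j * edge n j (x (Suc n))) = D (Suc n) (x (Suc n))"
  proof (cases "x (Suc n) \<le> Suc n")
    case True
    then show ?thesis by (simp add: D_Suc)
  next
    case False
    then show ?thesis by (simp add: D_eq_0 D_edge_eq_0)
  qed
  finally show ?thesis by (simp add: path_mass_def)
qed

lemma backward_prob_eq:
  "backward_prob l r n k j = D n j * edge n j k / D (Suc n) k"
  by (simp add: backward_prob_def edge_def)

text \<open>
  Downward induction on the start of the window: the marginal law settles a window of length one, and
  each backward transition adds one earlier time. If the later window has probability zero, the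
  condition on the transitions says nothing, and both sides have to be shown to vanish.
\<close>

lemma is_chain_law_window:
  assumes M: "is_chain_law l r V M" and "n \<le> m"
  shows "\<P>(\<omega> in M. \<forall>i\<in>{n..m}. \<omega> i = x i) = path_mass n m x * V (m, x m)"
  using \<open>n \<le> m\<close>
proof (induction n rule: inc_induct)
  case base
  interpret prob_space M using M by (simp add: is_chain_law_def)
  have sp: "space M = space chain_space"
    using M by (intro sets_eq_imp_space_eq) (simp add: is_chain_law_def)
  show ?case
  proof (cases "x m \<le> m")
    case True
    then show ?thesis
      using M by (auto simp: is_chain_law_def tri_def path_mass_def)
  next
    case False
    then have empty: "{\<omega>\<in>space M. \<forall>i\<in>{m..m}. \<omega> i = x i} = {}"
      using chain_space_le[of _ m] by (fastforce simp: sp)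
    show ?thesis
      unfolding empty using False by (simp add: path_mass_def D_eq_0)
  qed
next
  case (step n)
  interpret prob_space M using M by (simp add: is_chain_law_def)
  have setsM: "sets M = sets chain_space"
    using M by (simp add: is_chain_law_def)
  let ?E = "\<lambda>n. {\<omega>\<in>space M. \<forall>i\<in>{n..m}. \<omega> i = x i}"
  have E: "?E n = {\<omega>\<in>space M. \<omega> n = x n \<and> (\<forall>i\<in>{Suc n..m}. \<omega> i = x i)}"
    using step.hyps by (auto simp: Ball_def) (metis Suc_le_eq le_neq_implies_less)
  have IH: "prob (?E (Suc n)) = path_mass (Suc n) m x * V (m, x m)"
    using step.IH .
  show ?case
  proof (cases "x n \<le> n \<and> prob (?E (Suc n)) > 0")
    case True
    then have "prob (?E n) / prob (?E (Suc n)) = backward_prob l r n (x (Suc n)) (x n)"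
      using M step.hyps E by (simp add: is_chain_law_def cond_prob_def)
    then have "prob (?E n) = backward_prob l r n (x (Suc n)) (x n) * prob (?E (Suc n))"
      using True by (simp add: divide_eq_eq)
    moreover have "D (Suc n) (x (Suc n)) \<noteq> 0"
      using True IH by (auto simp: path_mass_def)
    then have "path_mass n m x = backward_prob l r n (x (Suc n)) (x n) * path_mass (Suc n) m x"
      using step.hyps path_mass_Suc_left[of n m x] by (simp add: backward_prob_eq field_simps)
    ultimately show ?thesis
      by (simp only: IH mult.assoc)
  next
    case False
    have "prob (?E n) = 0"
    proof (cases "x n \<le> n")
      case True
      have "prob (?E n) \<le> prob (?E (Suc n))"
        by (intro finite_measure_mono chain_event setsM) auto
      with True False show ?thesis by (smt (verit) measure_nonneg)
    next
      case False
      then have "?E n = {}"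
        unfolding E by (auto simp: sets_eq_imp_space_eq[OF setsM] dest!: chain_space_le[of _ n])
      then show ?thesis by (simp only: measure_empty)
    qed
    moreover have "path_mass n m x * V (m, x m) = 0"
    proof (cases "x n \<le> n \<and> D (Suc n) (x (Suc n)) \<noteq> 0")
      case True
      \<comment> \<open>The later window has probability zero, and the mass of the longer one is a multiple of it.\<close>
      then have "path_mass (Suc n) m x * V (m, x m) = 0"
        using False IH measure_nonneg[of M "?E (Suc n)"] by linarith
      moreover have "D (Suc n) (x (Suc n)) * (path_mass n m x * V (m, x m)) =
          D n (x n) * edge n (x n) (x (Suc n)) * (path_mass (Suc n) m x * V (m, x m))"
        using path_mass_Suc_left[OF step.hyps(2), of x] by (simp add: mult_ac)
      ultimately show ?thesis using True by auto
    next
      case False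
      then have "D n (x n) * edge n (x n) (x (Suc n)) = 0"
        using D_eq_0[of n "x n"] D_edge_eq_0[of n "x (Suc n)" "x n"] D_pos[of "x (Suc n)" "Suc n"]
        by fastforce
      then show ?thesis
        using step.hyps by (auto simp: path_mass_def prod.atLeast_Suc_lessThan)
    qed
    ultimately show ?thesis by simp
  qed
qed

text \<open>
  The converse: probabilities of initial windows give those of all windows by summing over
  the first state, and the backward transition probabilities are quotients of two window
  probabilities.
\<close>

lemma is_chain_lawI:
  assumes M: "prob_space M" "sets M = sets chain_space"
    and cyl: "\<And>m x. \<P>(\<omega> in M. \<forall>i\<in>{0..m}. \<omega> i = x i) = path_mass 0 m x * V (m, x m)"
  shows "is_chain_law l r V M"
proof -
  interpret prob_space M by fact
  have sp: "space M = space chain_space"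
    by (rule sets_eq_imp_space_eq) fact
  have window: "\<P>(\<omega> in M. \<forall>i\<in>{n..m}. \<omega> i = x i) = path_mass n m x * V (m, x m)"
    if "n \<le> m" for n m x
    using that
  proof (induction n arbitrary: x)
    case 0
    then show ?case by (simp only: cyl)
  next
    case (Suc n)
    let ?E = "\<lambda>j. {\<omega>\<in>space M. \<forall>i\<in>{n..m}. \<omega> i = (x(n := j)) i}"
    have split: "{n..m} = insert n {Suc n..m}"
      using Suc.prems by auto
    have "{\<omega>\<in>space M. \<forall>i\<in>{Suc n..m}. \<omega> i = x i} = (\<Union>j\<in>{..n}. ?E j)"
      using chain_space_le[of _ n] by (auto simp: sp split)
    also have "prob \<dots> = (\<Sum>j\<le>n. prob (?E j))"
    proof (rule finite_measure_finite_Union)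
      have "?E j \<in> events" for j
        by (rule chain_event[OF M(2), where Q = "\<lambda>i z. z = (x(n := j)) i"]) simp
      then show "?E ` {..n} \<subseteq> events" by blast
      show "disjoint_family_on ?E {..n}"
        unfolding disjoint_family_on_def split by auto
    qed simp
    also have "\<dots> = (\<Sum>j\<le>n. path_mass n m (x(n := j)) * V (m, x m))"
      using Suc.prems by (intro sum.cong refl) (subst Suc.IH; simp)
    also have "\<dots> = path_mass (Suc n) m x * V (m, x m)"
      using Suc.prems by (simp add: sum_path_mass flip: sum_distrib_right)
    finally show ?case .
  qed
  have marginal: "\<P>(\<omega> in M. \<omega> n = k) = D n k * V (n, k)" for n k
    using window[of n n "\<lambda>_. k"] by (simp add: path_mass_def)
  have backward: "\<P>(\<omega> in M. \<omega> n = j \<bar> \<forall>i\<in>{Suc n..m}. \<omega> i = x i) = backward_prob l r n (x (Suc n)) j"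
    if "n < m" "j \<le> n" and pos: "\<P>(\<omega> in M. \<forall>i\<in>{Suc n..m}. \<omega> i = x i) > 0" for n m x j
  proof -
    have "\<P>(\<omega> in M. \<omega> n = j \<bar> \<forall>i\<in>{Suc n..m}. \<omega> i = x i) =
        \<P>(\<omega> in M. \<forall>i\<in>{n..m}. \<omega> i = (x(n := j)) i) / \<P>(\<omega> in M. \<forall>i\<in>{Suc n..m}. \<omega> i = x i)"
    proof -
      have "{n..m} = insert n {Suc n..m}" using that(1) by auto
      then have "{\<omega>\<in>space M. \<forall>i\<in>{n..m}. \<omega> i = (x(n := j)) i} =
          {\<omega>\<in>space M. \<omega> n = j \<and> (\<forall>i\<in>{Suc n..m}. \<omega> i = x i)}" by auto
      then show ?thesis by (simp add: cond_prob_def)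
    qed
    also have "\<dots> = path_mass n m (x(n := j)) * V (m, x m) / (path_mass (Suc n) m x * V (m, x m))"
      using that(1) by (subst (1 2) window) auto
    also have "\<dots> = backward_prob l r n (x (Suc n)) j"
    proof -
      have nz: "path_mass (Suc n) m x * V (m, x m) \<noteq> 0"
        using pos window[of "Suc n" m x] that(1) by auto
      then have "D (Suc n) (x (Suc n)) \<noteq> 0" by (auto simp: path_mass_def)
      moreover have "path_mass (Suc n) m (x(n := j)) = path_mass (Suc n) m x"
        by (simp add: path_mass_def)
      ultimately show ?thesis
        using nz path_mass_Suc_left[OF that(1), of "x(n := j)"]
        by (simp add: backward_prob_eq field_simps)
    qed
    finally show ?thesis .
  qed
  show ?thesis
    using M marginal backward by (auto simp: is_chain_law_def)
qed

text \<open>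
  An event that depends on finitely many coordinates is a finite disjoint union of initial
  cylinders, whose masses are prescribed.
\<close>

lemma is_chain_law_unique:
  assumes M: "is_chain_law l r V M" and N: "is_chain_law l r V N"
  shows "M = N"
proof (rule measure_eqI_PiM_infinite)
  show sets: "sets M = sets chain_space" "sets N = sets chain_space"
    using M N by (simp_all add: is_chain_law_def)
  interpret M: prob_space M using M by (simp add: is_chain_law_def)
  interpret N: prob_space N using N by (simp add: is_chain_law_def)
  show "finite_measure M" by (rule M.finite_measure_axioms)
  fix A :: "nat \<Rightarrow> nat set" and J :: "nat set"
  assume J: "finite J" and A: "\<And>i. i \<in> J \<Longrightarrow> A i \<in> sets (count_space {0..i})"
  define E where "E = prod_emb UNIV (\<lambda>n. count_space {0..n}) J (Pi\<^sub>E J A)"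
  obtain m where m: "J \<subseteq> {0..m}"
    using J by (auto simp: finite_nat_iff_bounded_le atMost_atLeast0)
  \<comment> \<open>Paths up to time m, one representative for each initial cylinder inside E.\<close>
  define Y where "Y = {y \<in> \<Pi>\<^sub>E i\<in>{0..m}. {0..i}. \<forall>i\<in>J. y i \<in> A i}"
  have finY: "finite Y"
    unfolding Y_def by (intro finite_subset[OF _ finite_PiE[of "{0..m}" "\<lambda>i. {0..i}"]]) auto
  have mass: "measure L E = (\<Sum>y\<in>Y. path_mass 0 m y * V (m, y m))" if L: "is_chain_law l r V L" for L
  proof -
    interpret L: prob_space L using L by (simp add: is_chain_law_def)
    have setsL: "sets L = sets chain_space" using L by (simp add: is_chain_law_def)
    note sp = sets_eq_imp_space_eq[OF setsL]
    have "E = (\<Union>y\<in>Y. {\<omega>\<in>space L. \<forall>i\<in>{0..m}. \<omega> i = y i})" (is "_ = ?U")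
    proof
      show "E \<subseteq> ?U"
      proof
        fix \<omega> assume \<omega>: "\<omega> \<in> E"
        then have \<omega>_sp: "\<omega> \<in> space chain_space" and "\<forall>i\<in>J. \<omega> i \<in> A i"
          by (auto simp: E_def prod_emb_def space_PiM)
        then have "restrict \<omega> {0..m} \<in> Y"
          using m chain_space_le[OF \<omega>_sp] by (auto simp: Y_def)
        with \<omega>_sp show "\<omega> \<in> ?U" by (auto simp: sp intro!: bexI[of _ "restrict \<omega> {0..m}"])
      qed
      show "?U \<subseteq> E"
      proof
        fix \<omega> assume "\<omega> \<in> ?U"
        then obtain y where y: "y \<in> Y" "\<forall>i\<in>{0..m}. \<omega> i = y i" and \<omega>: "\<omega> \<in> space chain_space"
          by (auto simp: sp)
        then have "\<forall>i\<in>J. \<omega> i \<in> A i"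
          using m by (auto simp: Y_def subset_eq)
        with \<omega> show "\<omega> \<in> E"
          by (auto simp: E_def prod_emb_def space_PiM)
      qed
    qed
    also have "L.prob ?U = (\<Sum>y\<in>Y. L.prob {\<omega>\<in>space L. \<forall>i\<in>{0..m}. \<omega> i = y i})"
    proof (intro L.finite_measure_finite_Union finY)
      show "disjoint_family_on (\<lambda>y. {\<omega>\<in>space L. \<forall>i\<in>{0..m}. \<omega> i = y i}) Y"
        unfolding disjoint_family_on_def
      proof (intro ballI impI)
        fix y z assume yz: "y \<in> Y" "z \<in> Y" "y \<noteq> z"
        have "\<exists>i\<in>{0..m}. y i \<noteq> z i"
        proof (rule ccontr)
          assume "\<not> ?thesis"
          then have "y = z"
            using yz by (intro PiE_ext[of y "{0..m}" "\<lambda>i. {0..i}"]) (auto simp: Y_def)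
          with yz show False by simp
        qed
        then show "{\<omega>\<in>space L. \<forall>i\<in>{0..m}. \<omega> i = y i} \<inter> {\<omega>\<in>space L. \<forall>i\<in>{0..m}. \<omega> i = z i} = {}"
          by fastforce
      qed
      have "{\<omega>\<in>space L. \<forall>i\<in>{0..m}. \<omega> i = y i} \<in> L.events" for y
        by (rule chain_event[OF setsL, where Q = "\<lambda>i z. z = y i"]) simp
      then show "(\<lambda>y. {\<omega>\<in>space L. \<forall>i\<in>{0..m}. \<omega> i = y i}) ` Y \<subseteq> L.events" by blast
    qed
    also have "\<dots> = (\<Sum>y\<in>Y. path_mass 0 m y * V (m, y m))"
      by (simp only: is_chain_law_window[OF L le0])
    finally show ?thesis .
  qed
  show "emeasure M (prod_emb UNIV (\<lambda>n. count_space {0..n}) J (Pi\<^sub>E J A)) =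
      emeasure N (prod_emb UNIV (\<lambda>n. count_space {0..n}) J (Pi\<^sub>E J A))"
    unfolding E_def[symmetric] M.emeasure_eq_measure N.emeasure_eq_measure mass[OF M] mass[OF N] ..
qed

end

section \<open>The law of the chain exists\<close>

text \<open>
  Only one state of the past contributes to the mass of an atom, so the integral over the past
  collapses to a product and the masses of cylinders satisfy a recursion without integrals.
\<close>

lemma (in Ionescu_Tulcea) emeasure_C_singleton:
  assumes y: "y \<in> space (PiM {0..<n} M)" and a: "a \<in> space (M n)"
    and sets: "{y} \<in> sets (PiM {0..<n} M)" "{y(n := a)} \<in> sets (PiM {0..<Suc n} M)"
  shows "emeasure (C 0 (Suc n) (\<lambda>_. undefined)) {y(n := a)} =
    emeasure (C 0 n (\<lambda>_. undefined)) {y} * emeasure (P n y) {a}"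
proof -
  let ?C = "C 0 n (\<lambda>_. undefined)"
  have root: "(\<lambda>_. undefined) \<in> space (PiM {0..<0} M)" by simp
  have spC: "space ?C = space (PiM {0..<n} M)" and setsC: "sets ?C = sets (PiM {0..<n} M)"
    using space_C[OF root, of n] sets_C[OF root, of n] by simp_all
  have meas: "eP n \<in> measurable ?C (subprob_algebra (PiM {0..<Suc n} M))"
    using measurable_eP[of n] by (simp only: measurable_cong_sets[OF setsC refl])
  have "emeasure (C 0 (Suc n) (\<lambda>_. undefined)) {y(n := a)} =
      (\<integral>\<^sup>+\<omega>. emeasure (eP n \<omega>) {y(n := a)} \<partial>?C)"
    using y spC by (simp add: emeasure_bind[OF _ meas sets(2)])
  also have "\<dots> = (\<integral>\<^sup>+\<omega>. emeasure (P n y) {a} * indicator {y} \<omega> \<partial>?C)"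
  proof (rule nn_integral_cong)
    fix \<omega> assume "\<omega> \<in> space ?C"
    then have \<omega>: "\<omega> \<in> space (PiM {0..<n} M)" by (simp add: spC)
    have "(fun_upd \<omega> n) -` {y(n := a)} \<inter> space (M n) = (if \<omega> = y then {a} else {})"
    proof -
      have "\<omega> = y" if "fun_upd \<omega> n z = fun_upd y n a" for z
      proof (rule PiE_ext[of _ "{0..<n}" "\<lambda>i. space (M i)"])
        fix i assume "i \<in> {0..<n}"
        then show "\<omega> i = y i" using fun_cong[OF that, of i] by simp
      qed (use \<omega> y in \<open>simp_all add: space_PiM\<close>)
      then show ?thesis using a by (auto dest: fun_upd_eqD)
    qed
    then show "emeasure (eP n \<omega>) {y(n := a)} = emeasure (P n y) {a} * indicator {y} \<omega>"
      by (simp add: emeasure_eP[OF \<omega> sets(2)])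
  qed
  also have "\<dots> = emeasure ?C {y} * emeasure (P n y) {a}"
    using sets(1) by (subst nn_integral_cmult_indicator) (simp_all add: setsC mult.commute)
  finally show ?thesis .
qed

context weighted_triangle begin

text \<open>
  The Doob transform of the edge weights by \<open>V\<close>, which gives the chain in forward time. Where
  \<open>V (n, k) = 0\<close>, division by zero makes the chain stay at \<open>k\<close>; such states have probability zero.
\<close>

definition forward_prob :: "(nat \<times> nat \<Rightarrow> real) \<Rightarrow> nat \<Rightarrow> nat \<Rightarrow> real" where
  "forward_prob V n k = r (n, k) * V (Suc n, Suc k) / V (n, k)"

definition step_law :: "(nat \<times> nat \<Rightarrow> real) \<Rightarrow> nat \<Rightarrow> nat \<Rightarrow> nat measure" where
  "step_law V n k = distr (measure_pmf (bernoulli_pmf (forward_prob V n k))) (count_space {0..Suc n})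
     (\<lambda>b. if b then Suc k else k)"

lemma forward_prob_range:
  assumes V: "V \<in> harmonic_funs l r" and k: "k \<le> n"
  shows "0 \<le> forward_prob V n k" "forward_prob V n k \<le> 1"
proof -
  have "0 \<le> V (n, k)" "0 \<le> r (n, k) * V (Suc n, Suc k)" "0 \<le> l (n, k) * V (Suc n, k)"
    using k l_pos[OF k] r_pos[OF k] harmonic_nonneg[OF V] by simp_all
  then show "0 \<le> forward_prob V n k" "forward_prob V n k \<le> 1"
    using harmonic_rec[OF V k] by (auto simp: forward_prob_def divide_le_eq_1)
qed

lemma step_law_measurable:
  assumes "k \<le> n"
  shows "(\<lambda>b. if b then Suc k else k) \<in> measurable (measure_pmf p) (count_space {0..Suc n})"
  using assms by (auto simp: measurable_def)

lemma prob_space_step_law: "k \<le> n \<Longrightarrow> prob_space (step_law V n k)"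
  unfolding step_law_def by (intro prob_space.prob_space_distr step_law_measurable) (rule prob_space_measure_pmf)

text \<open>
  Multiplied out, so that it covers \<open>V (n, k) = 0\<close> as well: then both summands of
  the harmonic relation vanish.
\<close>

lemma step_law_mass:
  assumes V: "V \<in> harmonic_funs l r" and k: "k \<le> n" and c: "c \<le> Suc n"
  shows "V (n, k) * measure (step_law V n k) {c} = edge n k c * V (Suc n, c)"
proof -
  let ?q = "forward_prob V n k"
  have q: "0 \<le> ?q" "?q \<le> 1" using forward_prob_range[OF V k] .
  have nn: "0 \<le> r (n, k) * V (Suc n, Suc k)" "0 \<le> l (n, k) * V (Suc n, k)"
    using k l_pos[OF k] r_pos[OF k] harmonic_nonneg[OF V] by simp_all
  have up: "V (n, k) * ?q = r (n, k) * V (Suc n, Suc k)"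
    using nn harmonic_rec[OF V k]
    by (cases "V (n, k) = 0") (simp_all only: forward_prob_def, auto simp: add_nonneg_eq_0_iff)
  then have stay: "V (n, k) * (1 - ?q) = l (n, k) * V (Suc n, k)"
    using harmonic_rec[OF V k] by (simp add: algebra_simps)
  have "measure (step_law V n k) {c} =
      measure (measure_pmf (bernoulli_pmf ?q)) {b. (if b then Suc k else k) = c}"
    unfolding step_law_def using c
    by (subst measure_distr[OF step_law_measurable[OF k]]) (auto intro: arg_cong[where f = "measure _"])
  also have "{b. (if b then Suc k else k) = c} =
      (if c = Suc k then {True} else if c = k then {False} else {})"
    by (auto split: if_splits)
  also have "measure (measure_pmf (bernoulli_pmf ?q)) \<dots> =
      (if c = Suc k then ?q else if c = k then 1 - ?q else 0)"
    using q by (simp add: measure_pmf_single)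
  finally show ?thesis
    using up stay by (auto simp: edge_def)
qed

text \<open>
  The forward chain with transition laws \<open>step_law\<close> exists by the theorem of Ionescu Tulcea. Along a path
  its transition probabilities telescope, leaving the weight of the path times the last value of \<open>V\<close>;
  so its initial windows have the required masses.
\<close>

lemma chain_law_exists:
  assumes V: "V \<in> harmonic_funs l r"
  shows "\<exists>M. is_chain_law l r V M"
proof -
  define S where "S = (\<lambda>n::nat. count_space {0..n})"
  define P where "P i \<omega> = (case i of 0 \<Rightarrow> return (S 0) 0 | Suc n \<Rightarrow> step_law V n (\<omega> n))"
    for i and \<omega> :: "nat \<Rightarrow> nat"
  have sp_le: "\<omega> i \<le> i" if "\<omega> \<in> space (PiM I S)" "i \<in> I" for \<omega> i I
    using that by (auto simp: space_PiM S_def PiE_iff)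
  interpret IT: Ionescu_Tulcea P S
  proof (rule Ionescu_Tulcea.intro)
    show "P i \<in> measurable (PiM {0..<i} S) (subprob_algebra (S i))" for i
    proof (cases i)
      case 0
      have "P 0 = (\<lambda>_. return (S 0) 0)" by (simp add: P_def fun_eq_iff)
      moreover have "return (S 0) 0 \<in> space (subprob_algebra (S 0))"
        by (auto simp: space_subprob_algebra S_def intro!: prob_space_imp_subprob_space prob_space_return)
      ultimately show ?thesis using 0 by simp
    next
      case (Suc n)
      have "step_law V n \<in> measurable (S n) (subprob_algebra (S (Suc n)))"
        using prob_space_step_law[THEN prob_space_imp_subprob_space]
        by (simp add: S_def space_subprob_algebra Pi_iff) (simp add: step_law_def)
      moreover have "(\<lambda>\<omega>. \<omega> n) \<in> measurable (PiM {0..<Suc n} S) (S n)"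
        by (rule measurable_component_singleton) simp
      ultimately have "(\<lambda>\<omega>. step_law V n (\<omega> n)) \<in> measurable (PiM {0..<Suc n} S) (subprob_algebra (S (Suc n)))"
        by (rule measurable_compose[rotated])
      moreover have "P (Suc n) = (\<lambda>\<omega>. step_law V n (\<omega> n))"
        by (simp add: P_def fun_eq_iff)
      ultimately show ?thesis using Suc by simp
    qed
    show "prob_space (P i \<omega>)" if \<omega>: "\<omega> \<in> space (PiM {0..<i} S)" for i \<omega>
    proof (cases i)
      case 0
      then show ?thesis by (auto simp: P_def S_def intro!: prob_space_return)
    next
      case (Suc n)
      then show ?thesis using sp_le[OF \<omega>, of n] by (simp add: P_def prob_space_step_law)
    qed
  qed
  let ?u = "\<lambda>_::nat. undefined :: nat"
  have single: "{restrict x {0..<n}} \<in> sets (PiM {0..<n} S)" if "\<And>i. i < n \<Longrightarrow> x i \<le> i" for x n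
  proof -
    have "{restrict x {0..<n}} = (\<Pi>\<^sub>E i\<in>{0..<n}. {x i})" by (auto simp: PiE_iff fun_eq_iff extensional_def restrict_def)
    also have "\<dots> \<in> sets (PiM {0..<n} S)"
      using that by (intro sets_PiM_I_finite) (auto simp: S_def)
    finally show ?thesis .
  qed
  have C: "emeasure (IT.C 0 (Suc m) ?u) {restrict x {0..<Suc m}} = ennreal (path_mass 0 m x * V (m, x m))"
    if "\<And>i. i \<le> m \<Longrightarrow> x i \<le> i" for m x
    using that
  proof (induction m)
    case 0
    have "restrict x {0..<Suc 0} = ?u(0 := 0)"
      using 0[of 0] by (auto simp: restrict_def fun_eq_iff)
    moreover have "emeasure (IT.C 0 (Suc 0) ?u) {?u(0 := 0)} =
        emeasure (IT.C 0 0 ?u) {?u} * emeasure (P 0 ?u) {0}"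
      using single[of 0 ?u] single[of 1 "\<lambda>_. 0"]
      by (intro IT.emeasure_C_singleton) (auto simp: S_def restrict_def fun_upd_def)
    moreover have "emeasure (IT.C 0 0 ?u) {?u} = 1"
      by (simp add: PiM_empty)
    moreover have "emeasure (P 0 ?u) {0} = 1"
      by (simp add: P_def S_def)
    moreover have "path_mass 0 0 x * V (0, x 0) = 1"
      using 0[of 0] harmonic_root[OF V] by (simp add: path_mass_def D_0)
    ultimately show ?case
      by (simp only: mult_1 ennreal_1)
  next
    case (Suc m)
    let ?y = "restrict x {0..<Suc m}"
    have y: "?y \<in> space (PiM {0..<Suc m} S)"
      using Suc.prems by (auto simp: space_PiM S_def)
    have upd: "restrict x {0..<Suc (Suc m)} = ?y(Suc m := x (Suc m))"
      by (auto simp: restrict_def fun_eq_iff)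
    have "emeasure (IT.C 0 (Suc (Suc m)) ?u) {restrict x {0..<Suc (Suc m)}} =
        emeasure (IT.C 0 (Suc m) ?u) {?y} * emeasure (P (Suc m) ?y) {x (Suc m)}"
      unfolding upd
    proof (rule IT.emeasure_C_singleton[OF y])
      show "x (Suc m) \<in> space (S (Suc m))" using Suc.prems[of "Suc m"] by (simp add: S_def)
      show "{?y} \<in> sets (PiM {0..<Suc m} S)" using Suc.prems by (intro single) simp
      show "{?y(Suc m := x (Suc m))} \<in> sets (PiM {0..<Suc (Suc m)} S)"
        unfolding upd[symmetric] using Suc.prems by (intro single) simp
    qed
    also have "emeasure (IT.C 0 (Suc m) ?u) {?y} = ennreal (path_mass 0 m x * V (m, x m))"
      using Suc.prems by (intro Suc.IH) simp
    also have "emeasure (P (Suc m) ?y) {x (Suc m)} =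
        ennreal (measure (step_law V m (x m)) {x (Suc m)})"
    proof -
      interpret K: prob_space "step_law V m (x m)"
        using Suc.prems[of m] by (simp add: prob_space_step_law)
      show ?thesis by (simp add: P_def K.emeasure_eq_measure)
    qed
    also have "ennreal (path_mass 0 m x * V (m, x m)) * ennreal (measure (step_law V m (x m)) {x (Suc m)}) =
        ennreal (path_mass 0 m x * (V (m, x m) * measure (step_law V m (x m)) {x (Suc m)}))"
      by (simp add: ennreal_mult''[symmetric] mult.assoc)
    also have "path_mass 0 m x * (V (m, x m) * measure (step_law V m (x m)) {x (Suc m)}) =
        path_mass 0 (Suc m) x * V (Suc m, x (Suc m))"
      using Suc.prems by (simp add: step_law_mass[OF V] path_mass_def)
    finally show ?case .
  qed
  let ?M = "IT.PF.lim"
  have setsM: "sets ?M = sets chain_space"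
    unfolding S_def[symmetric] by (rule IT.PF.sets_lim)
  have spM: "space ?M = space chain_space"
    by (rule sets_eq_imp_space_eq[OF setsM])
  have "prob_space ?M"
  proof (rule prob_spaceI)
    have "emeasure ?M (IT.PF.emb UNIV {} {?u}) = emeasure (IT.CI {}) {?u}"
      by (rule IT.lim) (auto simp: PiM_empty)
    also have "\<dots> = 1"
      using prob_space.emeasure_space_1[OF IT.PF.prob_space_P[of "{}"]] by (simp add: IT.CI_def space_PiM)
    also have "IT.PF.emb UNIV {} {?u} = space ?M"
      unfolding IT.PF.space_lim prod_emb_def space_PiM by (auto simp: restrict_def)
    finally show "emeasure ?M (space ?M) = 1" .
  qed
  then interpret M: prob_space ?M .
  have "is_chain_law l r V ?M"
  proof (rule is_chain_lawI[OF \<open>prob_space ?M\<close> setsM])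
    fix m x
    let ?E = "{\<omega>\<in>space ?M. \<forall>i\<in>{0..m}. \<omega> i = x i}"
    show "M.prob ?E = path_mass 0 m x * V (m, x m)"
    proof (cases "\<forall>i\<le>m. x i \<le> i")
      case True
      let ?x = "restrict x {0..<Suc m}"
      have E: "?E = IT.PF.emb UNIV {0..<Suc m} {?x}"
        by (auto simp: prod_emb_def restrict_def fun_eq_iff space_PiM)
           (metis less_Suc_eq_le)+
      have "emeasure ?M ?E = emeasure (IT.CI {0..<Suc m}) {?x}"
        unfolding E using True by (intro IT.lim single) auto
      also have "\<dots> = emeasure (IT.C 0 (Suc m) ?u) (IT.PF.emb {0..<Suc m} {0..<Suc m} {?x})"
        using True by (intro IT.emeasure_CI single) auto
      also have "IT.PF.emb {0..<Suc m} {0..<Suc m} {?x} = {?x}"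
        using True by (intro prod_emb_id) (auto simp: S_def)
      also have "emeasure (IT.C 0 (Suc m) ?u) {?x} = ennreal (path_mass 0 m x * V (m, x m))"
        using True by (intro C) simp
      finally have "ennreal (M.prob ?E) = ennreal (path_mass 0 m x * V (m, x m))"
        by (simp add: M.emeasure_eq_measure)
      moreover have "0 \<le> path_mass 0 m x * V (m, x m)"
        using True harmonic_nonneg[OF V]
        by (auto simp: path_mass_def intro!: mult_nonneg_nonneg prod_nonneg D_nonneg edge_nonneg)
      ultimately show ?thesis by simp
    next
      case False
      then obtain i where i: "i \<le> m" "\<not> x i \<le> i" by blast
      have "\<omega> \<notin> ?E" for \<omega>
        unfolding spM using i chain_space_le[of \<omega> i] by (auto intro!: bexI[of _ i])
      then have empty: "?E = {}" by blast
      have "path_mass 0 m x = 0"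
        using False path_mass_eq_0 by blast
      then show ?thesis unfolding empty by simp
    qed
  qed
  then show ?thesis by blast
qed

lemma chain_law_is_chain_law: "V \<in> harmonic_funs l r \<Longrightarrow> is_chain_law l r V (chain_law l r V)"
  unfolding chain_law_def using chain_law_exists is_chain_law_unique by (metis theI')

lemma chain_law_cum:
  assumes V: "V \<in> harmonic_funs l r"
  shows "\<P>(\<omega> in chain_law l r V. \<omega> n \<le> k) = cum V n k"
proof -
  let ?M = "chain_law l r V"
  have law: "is_chain_law l r V ?M" by (rule chain_law_is_chain_law[OF V])
  interpret prob_space ?M using law by (simp add: is_chain_law_def)
  have setsM: "sets ?M = sets chain_space" using law by (simp add: is_chain_law_def)
  have "{\<omega>\<in>space ?M. \<omega> n \<le> k} = (\<Union>j\<in>{..min k n}. {\<omega>\<in>space ?M. \<omega> n = j})"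
    using chain_space_le by (auto simp: sets_eq_imp_space_eq[OF setsM])
  also have "prob \<dots> = (\<Sum>j\<le>min k n. prob {\<omega>\<in>space ?M. \<omega> n = j})"
  proof (rule finite_measure_finite_Union)
    have "{\<omega>\<in>space ?M. \<omega> n = j} \<in> events" for j
      using chain_event[OF setsM, of "{n}" "\<lambda>_ i. i = j"] by simp
    then show "(\<lambda>j. {\<omega>\<in>space ?M. \<omega> n = j}) ` {..min k n} \<subseteq> events" by blast
  qed (auto simp: disjoint_family_on_def)
  also have "\<dots> = cum V n k"
    unfolding cum_def using law by (intro sum.cong) (auto simp: is_chain_law_def tri_def)
  finally show ?thesis .
qed

end

section \<open>The sequential boundary as an ordered subspace of the unit interval\<close>

theorem theorem4:
  fixes l r :: "nat \<times> nat \<Rightarrow> real"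
  assumes "\<And>n k. (n, k) \<in> tri \<Longrightarrow> l (n, k) > 0"
    and "\<And>n k. (n, k) \<in> tri \<Longrightarrow> r (n, k) > 0"
  shows "embedding_map (subtopology fun_topology (sequential_boundary l r)) (top_of_set {0..1})
           (\<lambda>V. l (0, 0) * V (1, 0)) \<and>
         (\<forall>V\<in>sequential_boundary l r. \<forall>V'\<in>sequential_boundary l r.
           stoch_less l r V V' \<longleftrightarrow> l (0, 0) * V (1, 0) > l (0, 0) * V' (1, 0))"
proof -
  interpret weighted_triangle l r
    using assms by unfold_locales (simp_all add: tri_def)
  have "stoch_less l r V V' \<longleftrightarrow> l (0, 0) * V (1, 0) > l (0, 0) * V' (1, 0)"
    if "V \<in> sequential_boundary l r" "V' \<in> sequential_boundary l r" for V V'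
    unfolding stoch_less_def chain_law_cum[OF boundary_harmonic[OF that(1)]]
      chain_law_cum[OF boundary_harmonic[OF that(2)]] cum_1_0[symmetric]
    by (rule boundary_order[OF that])
  then show ?thesis
    using boundary_embedding by blast
qed

end
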